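(* Let $G$ be a simple graph on $n\ge 3$ vertices and let $H$ be a simple graph on $n$ vertices with $\theta(H)\le 3$. If $\delta(G)\ge n/2$ or $\delta_2(G)\ge n$, then $H$ is a subgraph of $G$.
   Context: The Ore-degree $\theta(H)$ of a graph $H$ is the maximum of $\deg_H(x)+\deg_H(y)$ over all edges $xy\in E(H)$ (and is $0$ if $H$ has no edges). For a graph $G$, $\delta_2(G)=\min\{\deg_G(x)+\deg_G(y): x\neq y,\ xy\notin E(G)\}$, the minimum over pairs of distinct non-adjacent vertices. *)

theory Defs
  imports Complex_Main "HOL-Library.Extended_Nat"
begin

type_synonym 'a ugraph = "'a set \<times> 'a set set"

abbreviation vertices :: "'a ugraph \<Rightarrow> 'a set" where
  "vertices G \<equiv> fst G"

abbreviation edges :: "'a ugraph \<Rightarrow> 'a set set" where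
  "edges G \<equiv> snd G"

definition simple_graph :: "'a ugraph \<Rightarrow> bool" where
  "simple_graph G \<longleftrightarrow>
     finite (vertices G) \<and> (\<forall>e\<in>edges G. e \<subseteq> vertices G \<and> card e = 2)"

definition degree :: "'a ugraph \<Rightarrow> 'a \<Rightarrow> nat" where
  "degree G x = card {y \<in> vertices G. {x, y} \<in> edges G}"

definition min_degree :: "'a ugraph \<Rightarrow> nat" where
  "min_degree G = Min (degree G ` vertices G)"

text \<open>The minimum is taken in the extended naturals, so that it is \<open>\<infinity>\<close> for a complete
  graph, where there is no pair of distinct non-adjacent vertices.\<close>

definition min_degree_sum :: "'a ugraph \<Rightarrow> enat" where
  "min_degree_sum G =
     Inf {enat (degree G x + degree G y) | x y.
            x \<in> vertices G \<and> y \<in> vertices G \<and> x \<noteq> y \<and> {x, y} \<notin> edges G}"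

definition ore_degree :: "'a ugraph \<Rightarrow> nat" where
  "ore_degree H =
     (if edges H = {} then 0
      else Max {degree H x + degree H y | x y. {x, y} \<in> edges H})"

definition subgraph :: "'a ugraph \<Rightarrow> 'a ugraph \<Rightarrow> bool" where
  "subgraph H G \<longleftrightarrow> vertices H \<subseteq> vertices G \<and> edges H \<subseteq> edges G"

definition relabel :: "('a \<Rightarrow> 'b) \<Rightarrow> 'a ugraph \<Rightarrow> 'b ugraph" where
  "relabel f H = (f ` vertices H, (\<lambda>e. f ` e) ` edges H)"

text \<open>``\<open>H\<close> is a subgraph of \<open>G\<close>'' for graphs on unrelated vertex sets: some isomorphic copy
  of \<open>H\<close> is a (not necessarily induced) subgraph of \<open>G\<close>.\<close>

definition is_subgraph_of :: "'a ugraph \<Rightarrow> 'b ugraph \<Rightarrow> bool" where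
  "is_subgraph_of H G \<longleftrightarrow> (\<exists>f. inj_on f (vertices H) \<and> subgraph (relabel f H) G)"

end

theory Submission imports Defs begin

text \<open>
  The hypothesis on the Ore-degree forces every component of \<open>H\<close> to be a path on at most three
  vertices, so the vertices of \<open>H\<close> can be listed with all edges joining consecutive
  entries. It therefore suffices that \<open>G\<close> has a Hamiltonian path. Both degree hypotheses give
  Ore's condition, and a cyclic arrangement of the vertices of \<open>G\<close> with a non-adjacent pair of
  neighbours can then be improved by reversing a segment.
\<close>

section \<open>Gaps in vertex lists and Ore's exchange argument\<close>

fun gaps :: "('a \<Rightarrow> 'a \<Rightarrow> bool) \<Rightarrow> 'a list \<Rightarrow> nat" where
  "gaps E (x # y # zs) = of_bool (\<not> E x y) + gaps E (y # zs)"
| "gaps E _ = 0"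

definition cyclic_gaps :: "('a \<Rightarrow> 'a \<Rightarrow> bool) \<Rightarrow> 'a list \<Rightarrow> nat" where
  "cyclic_gaps E xs = gaps E xs + of_bool (\<not> E (last xs) (hd xs))"

lemma gaps_append:
  assumes "xs \<noteq> []" "ys \<noteq> []"
  shows "gaps E (xs @ ys) = gaps E xs + gaps E ys + of_bool (\<not> E (last xs) (hd ys))"
  using assms
proof (induction E xs rule: gaps.induct)
  case ("2_2" E v)
  then show ?case by (cases ys) auto
qed auto

lemma gaps_rev:
  assumes "symp E"
  shows "gaps E (rev xs) = gaps E xs"
  using assms
proof (induction E xs rule: gaps.induct)
  case (1 E x y zs)
  then have "E y x = E x y" by (blast dest: sympD)
  then show ?case using 1 gaps_append[of "rev zs @ [y]" "[x]" E] by simp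
qed auto

lemma gap_position:
  assumes "gaps E xs \<noteq> 0"
  obtains as bs where "xs = as @ bs" "as \<noteq> []" "bs \<noteq> []" "\<not> E (last as) (hd bs)"
  using assms
proof (induction E xs arbitrary: thesis rule: gaps.induct)
  case (1 E x y zs)
  show ?case
  proof (cases "E x y")
    case True
    then obtain as bs where "y # zs = as @ bs" "as \<noteq> []" "bs \<noteq> []" "\<not> E (last as) (hd bs)"
      using 1 by auto
    then show ?thesis by (intro "1.prems"(1)[of "x # as" bs]) auto
  next
    case False
    then show ?thesis by (intro "1.prems"(1)[of "[x]" "y # zs"]) auto
  qed
qed auto

text \<open>Pigeonhole: record a neighbour of the first entry by the index of its predecessor, a
  neighbour of the last entry by its own index. All recorded indices lie below
  \<open>length ys - 1\<close>, while \<open>deg\<close> yields at least \<open>length ys\<close> of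
  them, so some index is recorded twice.\<close>

lemma crossing_position:
  assumes "ys \<noteq> []" "\<not> E (hd ys) (hd ys)" "\<not> E (last ys) (last ys)"
    and deg: "card {z \<in> set ys. E (hd ys) z} + card {z \<in> set ys. E (last ys) z} \<ge> length ys"
  shows "\<exists>i. Suc i < length ys \<and> E (last ys) (ys ! i) \<and> E (hd ys) (ys ! Suc i)"
proof (rule ccontr)
  assume none: "\<not> ?thesis"
  let ?A = "{i. Suc i < length ys \<and> E (hd ys) (ys ! Suc i)}"
  let ?B = "{i. Suc i < length ys \<and> E (last ys) (ys ! i)}"
  have fin: "finite ?A" "finite ?B"
    by (auto intro: finite_subset[of _ "{..<length ys}"])
  have "{z \<in> set ys. E (hd ys) z} \<subseteq> (\<lambda>i. ys ! Suc i) ` ?A"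
  proof
    fix z assume z: "z \<in> {z \<in> set ys. E (hd ys) z}"
    then obtain j where j: "j < length ys" "z = ys ! j" by (auto simp: in_set_conv_nth)
    \<comment> \<open>Position 0 holds \<open>hd ys\<close>, which is not its own neighbour, so
      every neighbour has a predecessor; likewise below, the last position drops out of
      \<open>?B\<close>.\<close>
    with z assms obtain i where "j = Suc i" by (cases j) (auto simp: hd_conv_nth)
    with z j show "z \<in> (\<lambda>i. ys ! Suc i) ` ?A" by auto
  qed
  then have A: "card {z \<in> set ys. E (hd ys) z} \<le> card ?A"
    using fin by (meson surj_card_le)
  have "{z \<in> set ys. E (last ys) z} \<subseteq> (\<lambda>i. ys ! i) ` ?B"
  proof
    fix z assume z: "z \<in> {z \<in> set ys. E (last ys) z}"
    then obtain j where j: "j < length ys" "z = ys ! j" by (auto simp: in_set_conv_nth)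
    have "j \<noteq> length ys - 1" using z j assms by (auto simp: last_conv_nth)
    with j have "Suc j < length ys" by linarith
    with z j show "z \<in> (\<lambda>i. ys ! i) ` ?B" by auto
  qed
  then have B: "card {z \<in> set ys. E (last ys) z} \<le> card ?B"
    using fin by (meson surj_card_le)
  have "card ?A + card ?B = card (?A \<union> ?B)"
    using none fin by (intro card_Un_disjoint[symmetric]) auto
  also have "\<dots> \<le> card {..<length ys - 1}" by (intro card_mono) auto
  also have "\<dots> < length ys" using assms(1) by simp
  finally show False using A B deg by linarith
qed

text \<open>Cyclic gaps make the count invariant under rotation, so that a given gap can be moved to
  the ends of the list.\<close>

lemma ore_hamiltonian_path:
  assumes "finite V" and sym: "symp E" and irr: "\<And>x. \<not> E x x"
    and ore: "\<And>x y. \<lbrakk>x \<in> V; y \<in> V; x \<noteq> y; \<not> E x y\<rbrakk> \<Longrightarrow>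
      card {z \<in> V. E x z} + card {z \<in> V. E y z} \<ge> card V"
  shows "\<exists>xs. distinct xs \<and> set xs = V \<and> gaps E xs = 0"
proof -
  obtain xs where "distinct xs" "set xs = V"
    using finite_distinct_list[OF \<open>finite V\<close>] by blast
  then show ?thesis
  proof (induction "cyclic_gaps E xs" arbitrary: xs rule: less_induct)
    case less
    show ?case
    proof (cases "gaps E xs = 0")
      case True
      then show ?thesis using less.prems by blast
    next
      case False
      then obtain as bs where xs: "xs = as @ bs" "as \<noteq> []" "bs \<noteq> []"
        and gap: "\<not> E (last as) (hd bs)" by (rule gap_position)
      \<comment> \<open>Rotation turns the gap into the closing pair, so the two ends of
        \<open>ys\<close> are non-adjacent and Ore's condition applies to them.\<close>
      define ys where "ys = bs @ as"
      have ys: "distinct ys" "set ys = V" "ys \<noteq> []" "hd ys = hd bs" "last ys = last as"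
        using xs less.prems by (auto simp: ys_def)
      have cyc: "cyclic_gaps E ys = cyclic_gaps E xs"
        using xs by (simp add: cyclic_gaps_def ys_def gaps_append)
      have "hd bs \<noteq> last as"
        using xs less.prems by (metis disjoint_iff distinct_append hd_in_set last_in_set)
      moreover have "\<not> E (hd ys) (last ys)" using gap ys sym by (auto dest: sympD)
      moreover have "hd ys \<in> V" "last ys \<in> V" using ys hd_in_set last_in_set by metis+
      ultimately have "card {z \<in> set ys. E (hd ys) z} + card {z \<in> set ys. E (last ys) z} \<ge> length ys"
        using ore[of "hd ys" "last ys"] ys distinct_card[of ys] by auto
      then obtain i where i: "Suc i < length ys" "E (last ys) (ys ! i)" "E (hd ys) (ys ! Suc i)"
        using crossing_position[of ys E] ys irr by blast
      \<comment> \<open>Cut at the crossing and reverse the first segment. The new junction joins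
        \<open>hd ys\<close> to \<open>ys ! Suc i\<close> and the new closing pair is
        \<open>last ys\<close>, \<open>ys ! i\<close>; both are adjacent. Gaps inside the segments
        survive, but the closing gap of \<open>ys\<close> is gone.\<close>
      define ps where "ps = take (Suc i) ys"
      define qs where "qs = drop (Suc i) ys"
      have pq: "ys = ps @ qs" "ps \<noteq> []" "qs \<noteq> []" "last ps = ys ! i" "hd qs = ys ! Suc i"
        using i ys(3) by (simp_all add: ps_def qs_def last_conv_nth hd_drop_conv_nth)
      have "hd ps = hd ys" "last qs = last ys" using pq(1-3) by auto
      then have "cyclic_gaps E (rev ps @ qs) = gaps E ps + gaps E qs"
        using pq i by (simp add: cyclic_gaps_def gaps_append gaps_rev[OF sym] last_rev hd_rev)
      also have "\<dots> < cyclic_gaps E (ps @ qs)"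
        using pq gap ys by (simp add: cyclic_gaps_def gaps_append)
      finally have "cyclic_gaps E (rev ps @ qs) < cyclic_gaps E xs" using pq cyc by simp
      moreover have "distinct (rev ps @ qs)" "set (rev ps @ qs) = V" using pq(1) ys by auto
      ultimately show ?thesis by (rule less.hyps)
    qed
  qed
qed

section \<open>Arranging disjoint short paths in one list\<close>

definition consecutive :: "'a list \<Rightarrow> 'a \<Rightarrow> 'a \<Rightarrow> bool" where
  "consecutive xs x y \<longleftrightarrow> (\<exists>as bs. xs = as @ x # y # bs \<or> xs = as @ y # x # bs)"

lemma consecutive_appendI1: "consecutive xs x y \<Longrightarrow> consecutive (xs @ ys) x y"
  unfolding consecutive_def by (metis append.assoc append_Cons)

lemma consecutive_appendI2: "consecutive ys x y \<Longrightarrow> consecutive (xs @ ys) x y"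
  unfolding consecutive_def by (metis append.assoc)

lemma consecutive_commute: "consecutive xs x y \<Longrightarrow> consecutive xs y x"
  unfolding consecutive_def by blast

lemma gaps_0_consecutive:
  assumes "gaps E xs = 0" "symp E" "consecutive xs x y"
  shows "E x y"
proof -
  have *: "E u v" if "xs = as @ u # v # bs" for as bs u v
    using that assms(1) gaps_append[of as "u # v # bs" E] by (cases "as = []") auto
  show ?thesis using assms(2,3) * unfolding consecutive_def by (blast dest: sympD)
qed

lemma consecutive_map:
  assumes "consecutive xs x y"
  shows "consecutive (map f xs) (f x) (f y)"
proof -
  from assms consider as bs where "xs = as @ x # y # bs" | as bs where "xs = as @ y # x # bs"
    unfolding consecutive_def by blast
  then show ?thesis
    unfolding consecutive_def by cases (metis list.simps(9) map_append)+
qed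

text \<open>For symmetric irreflexive \<open>E\<close>, a local way to say that components are paths
  on at most three vertices. Bounding all quantifiers by \<open>V\<close> makes it pass to
  subsets.\<close>

definition short_path_components :: "('a \<Rightarrow> 'a \<Rightarrow> bool) \<Rightarrow> 'a set \<Rightarrow> bool" where
  "short_path_components E V \<longleftrightarrow>
     (\<forall>x\<in>V. \<forall>y\<in>V. \<forall>z\<in>V. \<forall>w\<in>V. E x y \<and> E x z \<and> y \<noteq> z \<longrightarrow>
        (E y w \<longrightarrow> w = x) \<and> (E x w \<longrightarrow> w = y \<or> w = z))"

lemma short_path_components_subset:
  "short_path_components E V \<Longrightarrow> W \<subseteq> V \<Longrightarrow> short_path_components E W"
  unfolding short_path_components_def by (meson subsetD)

text \<open>\<open>ps\<close> is the whole component of the edge \<open>xy\<close>, listed along the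
  path; being closed under adjacency, it can be split off from \<open>V\<close>.\<close>

lemma small_path_component:
  assumes sym: "symp E" and irr: "\<And>x. \<not> E x x"
    and short: "short_path_components E V"
    and xy: "x \<in> V" "y \<in> V" "E x y"
  shows "\<exists>ps. ps \<noteq> [] \<and> distinct ps \<and> set ps \<subseteq> V \<and>
    (\<forall>u\<in>set ps. \<forall>v\<in>V. E u v \<longrightarrow> v \<in> set ps \<and> consecutive ps u v)"
proof -
  have nbr: "(E y w \<longrightarrow> w = x) \<and> (E x w \<longrightarrow> w = y \<or> w = z)"
    if "x \<in> V" "y \<in> V" "z \<in> V" "w \<in> V" "E x y" "E x z" "y \<noteq> z" for x y z w
    using short[unfolded short_path_components_def, rule_format, of x y z w] that by blast
  \<comment> \<open>The three-vertex case with centre \<open>c\<close>: the centre goes in the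
    middle, and \<open>nbr\<close> rules out further neighbours of the leaves and of the
    centre.\<close>
  have cherry: ?thesis if h: "c \<in> V" "a \<in> V" "b \<in> V" "E c a" "E c b" "a \<noteq> b" for a b c
  proof -
    have con: "consecutive [a, c, b] a c" "consecutive [a, c, b] c b"
      unfolding consecutive_def by (metis append_Nil, metis append_Cons append_Nil)
    have "v \<in> {a, c, b} \<and> consecutive [a, c, b] u v" if uv: "u \<in> {a, c, b}" "v \<in> V" "E u v" for u v
    proof -
      consider "u = a" | "u = b" | "u = c" using uv(1) by blast
      then show ?thesis
      proof cases
        case 1
        then have "v = c" using nbr[of c a b v] h uv by blast
        then show ?thesis using 1 con by simp
      next
        case 2
        then have "v = c" using nbr[of c b a v] h uv by blast
        then show ?thesis using 2 consecutive_commute[OF con(2)] by simp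
      next
        case 3
        then have "v = a \<or> v = b" using nbr[of c a b v] h uv by blast
        then show ?thesis using 3 con(2) consecutive_commute[OF con(1)] by auto
      qed
    qed
    moreover have "distinct [a, c, b]" using h irr by auto
    ultimately show ?thesis using h by (intro exI[of _ "[a, c, b]"]) simp
  qed
  \<comment> \<open>Either end of the edge may be the centre of a cherry; if neither is, the edge is
    a component by itself.\<close>
  consider z where "z \<in> V" "E x z" "z \<noteq> y" | z where "z \<in> V" "E y z" "z \<noteq> x"
    | "\<forall>z\<in>V. (E x z \<longrightarrow> z = y) \<and> (E y z \<longrightarrow> z = x)" by blast
  then show ?thesis
  proof cases
    case 1
    then show ?thesis using cherry[of x y z] xy by blast
  next
    case 2
    then show ?thesis using cherry[of y x z] xy sym by (blast dest: sympD)
  next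
    case 3
    have con: "consecutive [x, y] x y" unfolding consecutive_def by (metis append_Nil)
    have "x \<noteq> y" using xy irr by blast
    moreover have "v \<in> {x, y} \<and> consecutive [x, y] u v" if uv: "u \<in> {x, y}" "v \<in> V" "E u v" for u v
    proof (cases "u = x")
      case True
      then show ?thesis using 3 uv con by blast
    next
      case False
      then show ?thesis using 3 uv consecutive_commute[OF con] by blast
    qed
    ultimately show ?thesis using xy by (intro exI[of _ "[x, y]"]) simp
  qed
qed

text \<open>Induction on \<open>V\<close>: put one component in front of an arrangement of the rest.
  Once no edges remain, the isolated vertices may come in any order.\<close>

lemma linear_arrangement:
  assumes "finite V" and sym: "symp E" and irr: "\<And>x. \<not> E x x"
    and short: "short_path_components E V"
  shows "\<exists>xs. distinct xs \<and> set xs = V \<and> (\<forall>x\<in>V. \<forall>y\<in>V. E x y \<longrightarrow> consecutive xs x y)"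
  using \<open>finite V\<close> short
proof (induction V rule: finite_psubset_induct)
  case (psubset V)
  show ?case
  proof (cases "\<exists>x\<in>V. \<exists>y\<in>V. E x y")
    case False
    then show ?thesis using finite_distinct_list[OF \<open>finite V\<close>] by blast
  next
    case True
    then obtain x y where "x \<in> V" "y \<in> V" "E x y" by blast
    from small_path_component[OF sym irr psubset.prems this]
    obtain ps where ps: "ps \<noteq> []" "distinct ps" "set ps \<subseteq> V"
      and closed': "\<forall>u\<in>set ps. \<forall>v\<in>V. E u v \<longrightarrow> v \<in> set ps \<and> consecutive ps u v"
      by (elim exE conjE)
    note closed = closed'[rule_format]
    let ?W = "V - set ps"
    have "?W \<subset> V" using ps by (cases ps) auto
    moreover have "short_path_components E ?W"
      by (rule short_path_components_subset[OF psubset.prems]) blast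
    ultimately have "\<exists>xs. distinct xs \<and> set xs = ?W \<and> (\<forall>x\<in>?W. \<forall>y\<in>?W. E x y \<longrightarrow> consecutive xs x y)"
      by (rule psubset.IH)
    then obtain xs where xs: "distinct xs" "set xs = ?W"
      and con: "\<forall>x\<in>?W. \<forall>y\<in>?W. E x y \<longrightarrow> consecutive xs x y" by (elim exE conjE)
    have "consecutive (ps @ xs) u v" if "u \<in> V" "v \<in> V" "E u v" for u v
    proof (cases "u \<in> set ps")
      case True
      then show ?thesis using closed that by (blast intro: consecutive_appendI1)
    next
      case False
      \<comment> \<open>An edge from \<open>u\<close> into \<open>ps\<close>, read from its other
        end, would put \<open>u\<close> into \<open>ps\<close> by closure.\<close>
      then have "v \<notin> set ps" using closed[of v u] that sym by (blast dest: sympD)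
      then show ?thesis using False con that by (blast intro: consecutive_appendI2)
    qed
    moreover have "distinct (ps @ xs)" "set (ps @ xs) = V" using ps xs by auto
    ultimately show ?thesis by blast
  qed
qed

section \<open>Degree conditions and the embedding\<close>

abbreviation adjacent :: "'a ugraph \<Rightarrow> 'a \<Rightarrow> 'a \<Rightarrow> bool" where
  "adjacent G x y \<equiv> {x, y} \<in> edges G"

lemma symp_adjacent: "symp (adjacent G)"
  by (rule sympI) (simp add: insert_commute)

lemma not_adjacent_self: "simple_graph G \<Longrightarrow> \<not> adjacent G x x"
  by (auto simp: simple_graph_def)

lemma adjacent_vertices: "simple_graph G \<Longrightarrow> adjacent G x y \<Longrightarrow> x \<in> vertices G \<and> y \<in> vertices G"
  by (auto simp: simple_graph_def)

lemma degree_sum_le_ore_degree: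
  assumes "simple_graph H" "adjacent H x y"
  shows "degree H x + degree H y \<le> ore_degree H"
proof -
  let ?S = "{degree H x + degree H y | x y. adjacent H x y}"
  \<comment> \<open>\<open>Max\<close> gives an upper bound only on a finite set, so
    \<open>?S\<close> is covered by an image of the pairs of vertices.\<close>
  have "?S \<subseteq> (\<lambda>(x, y). degree H x + degree H y) ` (vertices H \<times> vertices H)"
    using adjacent_vertices[OF assms(1)] by fastforce
  then have "finite ?S"
    using assms(1) by (meson finite_SigmaI finite_imageI finite_subset simple_graph_def)
  then show ?thesis using assms(2) by (auto simp: ore_degree_def intro!: Max_ge)
qed

lemma card_le_degree:
  assumes "simple_graph H" "A \<subseteq> {y. adjacent H x y}"
  shows "card A \<le> degree H x"
  unfolding degree_def using assms adjacent_vertices[OF assms(1)]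
  by (intro card_mono) (auto simp: simple_graph_def)

text \<open>Merges the two alternatives: two degrees of at least \<open>n / 2\<close> add up to
  \<open>n\<close>, and otherwise the sum for \<open>x\<close>, \<open>y\<close> is itself a member
  of the set whose infimum is taken.\<close>

lemma ore_condition:
  assumes "simple_graph G" "x \<in> vertices G" "y \<in> vertices G" "x \<noteq> y" "\<not> adjacent G x y"
    and "real (min_degree G) \<ge> real n / 2 \<or> min_degree_sum G \<ge> enat n"
  shows "degree G x + degree G y \<ge> n"
  using assms(6)
proof
  assume "real (min_degree G) \<ge> real n / 2"
  moreover have "min_degree G \<le> degree G x" "min_degree G \<le> degree G y"
    using assms by (auto simp: min_degree_def simple_graph_def intro!: Min_le)
  ultimately show ?thesis by linarith
next
  assume "min_degree_sum G \<ge> enat n"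
  also have "min_degree_sum G \<le> enat (degree G x + degree G y)"
    unfolding min_degree_sum_def using assms by (intro Inf_lower) blast
  finally show ?thesis by simp
qed

theorem theorem3:
  fixes G :: "'a ugraph" and H :: "'b ugraph" and n :: nat
  assumes "simple_graph G" and "card (vertices G) = n" and "n \<ge> 3"
    and "simple_graph H" and "card (vertices H) = n"
    and "ore_degree H \<le> 3"
    and "real (min_degree G) \<ge> real n / 2 \<or> min_degree_sum G \<ge> enat n"
  shows "is_subgraph_of H G"
proof -
  have "\<exists>gs. distinct gs \<and> set gs = vertices G \<and> gaps (adjacent G) gs = 0"
  proof (rule ore_hamiltonian_path)
    show "finite (vertices G)" using assms(1) by (simp add: simple_graph_def)
    show "card (vertices G) \<le> card {z \<in> vertices G. adjacent G x z} + card {z \<in> vertices G. adjacent G y z}"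
      if "x \<in> vertices G" "y \<in> vertices G" "x \<noteq> y" "\<not> adjacent G x y" for x y
      using ore_condition[OF assms(1) that assms(7)] assms(2) by (simp add: degree_def)
    show "\<not> adjacent G x x" for x using not_adjacent_self[OF assms(1)] .
  qed (rule symp_adjacent)
  then obtain gs where gs: "distinct gs" "set gs = vertices G" "gaps (adjacent G) gs = 0" by blast

  have ore: "degree H x + degree H y \<le> 3" if "adjacent H x y" for x y
    using degree_sum_le_ore_degree[OF assms(4) that] assms(6) by linarith
  have deg: "card A \<le> degree H x" if "A \<subseteq> {y. adjacent H x y}" for A x
    using card_le_degree[OF assms(4) that] .
  \<comment> \<open>Otherwise \<open>x\<close> and \<open>y\<close> both have degree at least 2, and
    the edge between them has degree sum at least 4.\<close>
  have pend: "w = x" if "adjacent H x y" "adjacent H x z" "y \<noteq> z" "adjacent H y w" for x y z w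
  proof (rule ccontr)
    assume "w \<noteq> x"
    moreover have "adjacent H y x" using that by (simp add: insert_commute)
    ultimately show False
      using deg[of "{y, z}" x] deg[of "{x, w}" y] ore[of x y] that by auto
  qed
  \<comment> \<open>Otherwise \<open>x\<close> has degree at least 3 and its neighbour
    \<open>y\<close> at least 1, again 4 in total.\<close>
  have centre: "w = y \<or> w = z"
    if "adjacent H x y" "adjacent H x z" "adjacent H x w" "y \<noteq> z" for x y z w
  proof (rule ccontr)
    assume "\<not> ?thesis"
    moreover have "adjacent H y x" using that by (simp add: insert_commute)
    ultimately show False
      using deg[of "{y, z, w}" x] deg[of "{x}" y] ore[of x y] that by auto
  qed
  have "\<exists>hs. distinct hs \<and> set hs = vertices H \<and>
    (\<forall>x\<in>vertices H. \<forall>y\<in>vertices H. adjacent H x y \<longrightarrow> consecutive hs x y)"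
  proof (rule linear_arrangement)
    show "finite (vertices H)" using assms(4) by (simp add: simple_graph_def)
    show "short_path_components (adjacent H) (vertices H)"
      using pend centre unfolding short_path_components_def by blast
    show "\<not> adjacent H x x" for x using not_adjacent_self[OF assms(4)] .
  qed (rule symp_adjacent)
  then obtain hs where hs: "distinct hs" "set hs = vertices H"
    and con: "\<And>x y. adjacent H x y \<Longrightarrow> consecutive hs x y"
    using adjacent_vertices[OF assms(4)] by blast

  have len: "length hs = length gs"
    using gs hs assms(2,5) distinct_card[of gs] distinct_card[of hs] by simp
  \<comment> \<open>Lay the arrangement of \<open>H\<close> along the Hamiltonian path of
    \<open>G\<close>, entry by entry; injectivity comes from the distinctness of
    \<open>gs\<close>.\<close>
  define f where "f = the \<circ> map_of (zip hs gs)"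
  have map: "map f hs = gs"
    using len hs by (intro nth_equalityI) (auto simp: f_def map_of_zip_nth)
  have "inj_on f (vertices H)" using map gs hs by (metis distinct_map)
  moreover have "f ` vertices H = vertices G" using map gs hs by (metis list.set_map)
  \<comment> \<open>An edge of \<open>H\<close> joins consecutive entries of \<open>hs\<close>,
    hence its image joins consecutive entries of the gap-free list \<open>gs\<close>.\<close>
  moreover have "f ` e \<in> edges G" if "e \<in> edges H" for e
  proof -
    have "card e = 2" using assms(4) that by (simp add: simple_graph_def)
    then obtain x y where e: "e = {x, y}" by (meson card_2_iff)
    then have "consecutive gs (f x) (f y)" using consecutive_map[OF con, of x y f] map that by simp
    then show ?thesis using gaps_0_consecutive[OF gs(3) symp_adjacent] e by simp
  qed
  ultimately show ?thesis
    unfolding is_subgraph_of_def subgraph_def relabel_def by (intro exI[of _ f]) auto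
qed

end
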